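(* Let $(X,E)$ be a finite simple undirected graph without loops in which every vertex has degree at least $1$, and let $\mathcal{M}_X$ be the Markov operator of the vertex lamplighter random walk on $X$. For every $\theta\in\{0,1\}^X$ and every $f\in L(X)$, \[ \mathcal{M}_X(\chi_\theta\otimes f)=\chi_\theta\otimes M_\theta f . \]
   Context: For a finite set $Y$, $L(Y)$ is the space of complex functions on $Y$. Write $x\sim y$ if $\{x,y\}\in E$, and $\deg(x)=|\{y\in X:y\sim x\}|$. The set $\{0,1\}^X$ is a group under pointwise addition mod $2$; for $x\in X$, $\delta_x\in\{0,1\}^X$ is the function equal to $1$ at $x$ and $0$ elsewhere. For $\theta,\omega\in\{0,1\}^X$ put $\chi_\theta(\omega)=(-1)^{\sum_{x\in X}\theta(x)\omega(x)}$. Let $\mathcal{L}(X)=\{0,1\}^X\times X$; for $F\in L(\{0,1\}^X)$ and $f\in L(X)$, $(F\otimes f)(\omega,x)=F(\omega)f(x)$. The vertex lamplighter random walk is the simple random walk on the graph with vertex set $\mathcal{L}(X)$ in which $(\omega,x)$ and $(\theta,y)$ are adjacent iff $x\sim y$ and $\omega(z)=\theta(z)$ for all $z\ne x,y$. Its Markov operator is the linear operator on $L(\mathcal{L}(X))$ determined by \[ [\mathcal{M}_X(F\otimes f)](\omega,x)=\frac{1}{4\deg(x)}\sum_{y\sim x}\big[F(\omega)+F(\omega+\delta_x)+F(\omega+\delta_y)+F(\omega+\delta_x+\delta_y)\big]f(y). \] For $\theta\in\{0,1\}^X$ let $X_\theta=\{x\in X:\theta(x)=0\}$ and define the linear operator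 $M_\theta:L(X)\to L(X)$ by $(M_\theta f)(x)=\frac{1}{\deg(x)}\sum_{y\in X_\theta,\,y\sim x}f(y)$ if $\theta(x)=0$, and $(M_\theta f)(x)=0$ if $\theta(x)=1$. *)

theory Defs
  imports Complex_Main "HOL-Library.Z2" "HOL-Library.Function_Algebras"
begin

text \<open>
  The finite vertex set \<open>X\<close> is the universe of a type \<open>'a\<close> of class \<^class>\<open>finite\<close>, so that \<open>L(X)\<close> is
  \<^typ>\<open>'a \<Rightarrow> complex\<close>, and \<open>{0,1}\<^sup>X\<close> is \<^typ>\<open>'a \<Rightarrow> bit\<close>: addition in \<^typ>\<open>bit\<close> is addition mod 2, and
  \<^theory>\<open>HOL-Library.Function_Algebras\<close> lifts it pointwise.
\<close>

definition simple_graph :: "'a set set \<Rightarrow> bool" where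
  "simple_graph E \<longleftrightarrow> (\<forall>e\<in>E. card e = 2)"

definition adjacent :: "'a set set \<Rightarrow> 'a \<Rightarrow> 'a \<Rightarrow> bool" where
  "adjacent E x y \<longleftrightarrow> {x, y} \<in> E"

definition vertex_degree :: "'a set set \<Rightarrow> 'a \<Rightarrow> nat" where
  "vertex_degree E x = card {y. adjacent E y x}"

definition random_walk_op :: "('b \<Rightarrow> 'b \<Rightarrow> bool) \<Rightarrow> ('b \<Rightarrow> complex) \<Rightarrow> ('b \<Rightarrow> complex)" where
  "random_walk_op adj \<Phi> u = (\<Sum>v | adj u v. \<Phi> v) / of_nat (card {v. adj u v})"

definition delta :: "'a \<Rightarrow> ('a \<Rightarrow> bit)" where
  "delta x = (\<lambda>y. if y = x then 1 else 0)"

definition character :: "('a::finite \<Rightarrow> bit) \<Rightarrow> ('a \<Rightarrow> bit) \<Rightarrow> complex" where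
  "character \<theta> \<omega> = (- 1) ^ (\<Sum>x\<in>UNIV. of_bit (\<theta> x) * of_bit (\<omega> x) :: nat)"

definition tensor :: "(('a \<Rightarrow> bit) \<Rightarrow> complex) \<Rightarrow> ('a \<Rightarrow> complex) \<Rightarrow> (('a \<Rightarrow> bit) \<times> 'a \<Rightarrow> complex)"
    (infixr "\<otimes>" 70) where
  "F \<otimes> f = (\<lambda>(\<omega>, x). F \<omega> * f x)"

definition lamplighter_adjacent ::
    "'a set set \<Rightarrow> ('a \<Rightarrow> bit) \<times> 'a \<Rightarrow> ('a \<Rightarrow> bit) \<times> 'a \<Rightarrow> bool" where
  "lamplighter_adjacent E = (\<lambda>(\<omega>, x) (\<theta>, y).
     adjacent E x y \<and> (\<forall>z. z \<noteq> x \<and> z \<noteq> y \<longrightarrow> \<omega> z = \<theta> z))"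

definition lamplighter_op ::
    "'a set set \<Rightarrow> (('a \<Rightarrow> bit) \<times> 'a \<Rightarrow> complex) \<Rightarrow> (('a \<Rightarrow> bit) \<times> 'a \<Rightarrow> complex)" where
  "lamplighter_op E = random_walk_op (lamplighter_adjacent E)"

definition zero_vertices :: "('a \<Rightarrow> bit) \<Rightarrow> 'a set" where
  "zero_vertices \<theta> = {x. \<theta> x = 0}"

definition restricted_op ::
    "'a set set \<Rightarrow> ('a \<Rightarrow> bit) \<Rightarrow> ('a \<Rightarrow> complex) \<Rightarrow> ('a \<Rightarrow> complex)" where
  "restricted_op E \<theta> f x =
     (if \<theta> x = 0
      then 1 / of_nat (vertex_degree E x) * (\<Sum>y | y \<in> zero_vertices \<theta> \<and> adjacent E y x. f y)
      else 0)"

text \<open>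
  The lamplighter operator is defined from the lamplighter graph; the lemmas below check that it is
  linear and acts on elementary tensors, which span \<open>L({0,1}\<^sup>X \<times> X)\<close>, by the switch-walk-switch
  formula.
\<close>

lemma adjacent_sym: "adjacent E x y \<longleftrightarrow> adjacent E y x"
  by (simp add: adjacent_def insert_commute)

lemma adjacent_irrefl: "simple_graph E \<Longrightarrow> \<not> adjacent E x x"
  by (auto simp: adjacent_def simple_graph_def)

lemma bit_double [simp]: "b + b = (0::bit)"
  by (cases b) auto

lemma delta_same [simp]: "delta x x = 1" and delta_other [simp]: "y \<noteq> x \<Longrightarrow> delta x y = 0"
  by (auto simp: delta_def)

lemma lamp_fibre:
  fixes \<omega> :: "'a \<Rightarrow> bit"
  assumes "x \<noteq> y"
  shows "{\<theta>. \<forall>z. z \<noteq> x \<and> z \<noteq> y \<longrightarrow> \<omega> z = \<theta> z} =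
    {\<omega>, \<omega> + delta x, \<omega> + delta y, \<omega> + delta x + delta y}" (is "?L = ?R")
proof
  show "?R \<subseteq> ?L" by (auto simp: delta_def)
  show "?L \<subseteq> ?R"
  proof
    fix \<theta> assume "\<theta> \<in> ?L"
    then have *: "\<And>z. z \<noteq> x \<Longrightarrow> z \<noteq> y \<Longrightarrow> \<theta> z = \<omega> z" by auto
    have "\<theta> = (if \<theta> x = \<omega> x then (if \<theta> y = \<omega> y then \<omega> else \<omega> + delta y)
      else (if \<theta> y = \<omega> y then \<omega> + delta x else \<omega> + delta x + delta y))"
    proof
      fix z
      show "\<theta> z = (if \<theta> x = \<omega> x then (if \<theta> y = \<omega> y then \<omega> else \<omega> + delta y)
        else (if \<theta> y = \<omega> y then \<omega> + delta x else \<omega> + delta x + delta y)) z"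
        using * assms by (cases "\<theta> z"; cases "\<omega> z"; cases "z = x"; cases "z = y") auto
    qed
    then show "\<theta> \<in> ?R" by (auto split: if_splits)
  qed
qed

lemma lamp_fibre_distinct:
  fixes \<omega> :: "'a \<Rightarrow> bit"
  assumes "x \<noteq> y"
  shows "distinct [\<omega>, \<omega> + delta x, \<omega> + delta y, \<omega> + delta x + delta y]"
proof -
  let ?p = "\<lambda>\<theta> :: 'a \<Rightarrow> bit. (\<theta> x, \<theta> y)"
  have "distinct (map ?p [\<omega>, \<omega> + delta x, \<omega> + delta y, \<omega> + delta x + delta y])"
    using assms by (cases "\<omega> x"; cases "\<omega> y") auto
  then show ?thesis by (rule distinct_map[THEN iffD1, THEN conjunct1])
qed

lemma lamplighter_op_eq:
  fixes E :: "'a::finite set set"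
  assumes "simple_graph E"
  shows "lamplighter_op E \<Phi> (\<omega>, x) = 1 / (4 * of_nat (vertex_degree E x)) *
    (\<Sum>y | adjacent E y x. \<Phi> (\<omega>, y) + \<Phi> (\<omega> + delta x, y) + \<Phi> (\<omega> + delta y, y)
       + \<Phi> (\<omega> + delta x + delta y, y))"
proof -
  let ?N = "{y. adjacent E y x}"
  let ?S = "\<lambda>y. {\<omega>, \<omega> + delta x, \<omega> + delta y, \<omega> + delta x + delta y}"
  have ne: "x \<noteq> y" if "y \<in> ?N" for y
    using that adjacent_irrefl[OF assms] by auto
  have nb: "{v. lamplighter_adjacent E (\<omega>, x) v} = prod.swap ` (SIGMA y:?N. ?S y)"
    (is "?A = _")
  proof -
    have "?A = prod.swap ` (SIGMA y:?N. {\<theta>. \<forall>z. z \<noteq> x \<and> z \<noteq> y \<longrightarrow> \<omega> z = \<theta> z})"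
      by (force simp: lamplighter_adjacent_def adjacent_sym[of E x] image_iff)
    also have "(SIGMA y:?N. {\<theta>. \<forall>z. z \<noteq> x \<and> z \<noteq> y \<longrightarrow> \<omega> z = \<theta> z}) = (SIGMA y:?N. ?S y)"
      by (rule Sigma_cong[OF refl]) (rule lamp_fibre, rule ne)
    finally show ?thesis .
  qed
  have sm: "(\<Sum>\<theta>\<in>?S y. g \<theta>) = g \<omega> + g (\<omega> + delta x) + g (\<omega> + delta y) + g (\<omega> + delta x + delta y)"
    if "y \<in> ?N" for y and g :: "('a \<Rightarrow> bit) \<Rightarrow> complex"
    using sum.distinct_set_conv_list[OF lamp_fibre_distinct[OF ne[OF that], of \<omega>], of g]
    by (simp only: list.set list.map sum_list.Cons sum_list.Nil add_0_right add.assoc)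
  have sum: "(\<Sum>v\<in>prod.swap ` (SIGMA y:?N. ?S y). g v) =
      (\<Sum>y\<in>?N. g (\<omega>, y) + g (\<omega> + delta x, y) + g (\<omega> + delta y, y) + g (\<omega> + delta x + delta y, y))"
    for g :: "_ \<Rightarrow> complex"
  proof -
    have "(\<Sum>v\<in>prod.swap ` (SIGMA y:?N. ?S y). g v) = (\<Sum>(y, \<theta>)\<in>(SIGMA y:?N. ?S y). g (\<theta>, y))"
      by (subst sum.reindex) (auto intro: sum.cong simp: inj_on_def)
    also have "\<dots> = (\<Sum>y\<in>?N. \<Sum>\<theta>\<in>?S y. g (\<theta>, y))"
      by (rule sum.Sigma[symmetric]) auto
    also have "\<dots> = (\<Sum>y\<in>?N. g (\<omega>, y) + g (\<omega> + delta x, y) + g (\<omega> + delta y, y) + g (\<omega> + delta x + delta y, y))"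
      by (rule sum.cong[OF refl]) (rule sm)
    finally show ?thesis .
  qed
  have cd: "of_nat (card ?A) = (4 * of_nat (vertex_degree E x) :: complex)"
    unfolding nb using sum[of "\<lambda>_. 1"] by (simp add: vertex_degree_def)
  show ?thesis
    unfolding lamplighter_op_def random_walk_op_def cd unfolding nb sum by simp
qed

lemma lamplighter_op_tensor:
  fixes E :: "'a::finite set set"
  assumes "simple_graph E"
  shows "lamplighter_op E (F \<otimes> f) (\<omega>, x) = 1 / (4 * of_nat (vertex_degree E x)) *
    (\<Sum>y | adjacent E y x.
       (F \<omega> + F (\<omega> + delta x) + F (\<omega> + delta y) + F (\<omega> + delta x + delta y)) * f y)"
  unfolding lamplighter_op_eq[OF assms] by (simp add: tensor_def distrib_right)

lemma lamplighter_op_add: "lamplighter_op E (\<Phi> + \<Psi>) = lamplighter_op E \<Phi> + lamplighter_op E \<Psi>"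
  by (rule ext) (simp add: lamplighter_op_def random_walk_op_def sum.distrib add_divide_distrib)

lemma lamplighter_op_scale: "lamplighter_op E (\<lambda>u. c * \<Phi> u) = (\<lambda>u. c * lamplighter_op E \<Phi> u)"
  by (rule ext) (simp add: lamplighter_op_def random_walk_op_def sum_distrib_left)

end

theory Submission
  imports Defs
begin

text \<open>
  A character is multiplicative, and \<open>\<chi>\<^sub>\<theta>(\<delta>\<^sub>x) = \<plusminus>1\<close> according to whether \<open>\<theta>(x)\<close> is \<open>0\<close> or \<open>1\<close>.
  So the bracket in the switch-walk-switch formula factors as
  \<open>\<chi>\<^sub>\<theta>(\<omega>) (1 + \<chi>\<^sub>\<theta>(\<delta>\<^sub>x)) (1 + \<chi>\<^sub>\<theta>(\<delta>\<^sub>y))\<close>, which is \<open>4 \<chi>\<^sub>\<theta>(\<omega>)\<close> if \<open>\<theta>\<close> vanishes at both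
  \<open>x\<close> and \<open>y\<close>, and \<open>0\<close> otherwise.
\<close>

text \<open>The exponent in \<open>character\<close> is a sum of naturals, not additive in \<omega>
  since \<open>bit\<close> addition wraps mod 2. In product form, multiplicativity can be checked
  vertex by vertex.\<close>

lemma character_eq_prod:
  "character \<theta> \<omega> = (\<Prod>x\<in>UNIV. if \<theta> x = 1 \<and> \<omega> x = 1 then - 1 else 1)"
  unfolding character_def power_sum
  by (rule prod.cong) (auto simp: bit_not_one_iff)

lemma character_add: "character \<theta> (\<omega> + \<eta>) = character \<theta> \<omega> * character \<theta> \<eta>"
  unfolding character_eq_prod prod.distrib[symmetric]
proof (rule prod.cong)
  fix x
  show "(if \<theta> x = 1 \<and> (\<omega> + \<eta>) x = 1 then - 1 else 1) =
    (if \<theta> x = 1 \<and> \<omega> x = 1 then - 1 else 1) * (if \<theta> x = 1 \<and> \<eta> x = 1 then - 1 else 1 :: complex)"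
    by (cases "\<omega> x"; cases "\<eta> x") auto
qed simp

lemma character_delta: "character \<theta> (delta x) = (if \<theta> x = 0 then 1 else - 1)"
proof -
  have "character \<theta> (delta x) =
      (\<Prod>y\<in>UNIV. if y = x then (if \<theta> x = 0 then 1 else - 1) else 1)"
    unfolding character_eq_prod by (rule prod.cong) (auto simp: delta_def)
  then show ?thesis by simp
qed

lemma character_switch_sum:
  "character \<theta> \<omega> + character \<theta> (\<omega> + delta x) + character \<theta> (\<omega> + delta y)
     + character \<theta> (\<omega> + delta x + delta y) =
   (if \<theta> x = 0 \<and> \<theta> y = 0 then 4 * character \<theta> \<omega> else 0)"
  by (simp add: character_add character_delta)

theorem lemma3p1:
  fixes E :: "'a::finite set set"
    and \<theta> :: "'a \<Rightarrow> bit"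
    and f :: "'a \<Rightarrow> complex"
  assumes "simple_graph E"
    and "\<And>x. vertex_degree E x \<ge> 1"
  shows "lamplighter_op E (character \<theta> \<otimes> f) = character \<theta> \<otimes> restricted_op E \<theta> f"
proof (rule ext, clarify)
  fix \<omega> x
  show "lamplighter_op E (character \<theta> \<otimes> f) (\<omega>, x) = (character \<theta> \<otimes> restricted_op E \<theta> f) (\<omega>, x)"
  proof (cases "\<theta> x = 0")
    case True
    \<comment> \<open>Neighbours with \<open>\<theta> y = 1\<close> contribute 0; the surviving
      factor 4 cancels the 4 in the normalisation.\<close>
    have "(\<Sum>y | adjacent E y x. (if \<theta> y = 0 then 4 * character \<theta> \<omega> else 0) * f y) =
        (\<Sum>y | y \<in> zero_vertices \<theta> \<and> adjacent E y x. 4 * character \<theta> \<omega> * f y)"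
      by (rule sum.mono_neutral_cong_right) (auto simp: zero_vertices_def)
    with True show ?thesis
      unfolding lamplighter_op_tensor[OF assms(1)] character_switch_sum
      by (simp add: tensor_def restricted_op_def sum_distrib_left[symmetric])
  next
    case False
    \<comment> \<open>Here every bracket vanishes, whatever \<open>\<theta> y\<close> is, so both
      sides are 0.\<close>
    then show ?thesis
      unfolding lamplighter_op_tensor[OF assms(1)] character_switch_sum
      by (simp add: tensor_def restricted_op_def)
  qed
qed

end
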